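(* Let $\mathbf{R}\in\mathbb{R}^{d\times d}$ be a symmetric positive semi-definite matrix with $\lambda_1(\mathbf{R})>\lambda_d(\mathbf{R})$, and let $1<\kappa_{max}<\kappa(\mathbf{R})$ be a fixed finite number. Let $\mathbf{R}_{RR}$ and $\mathbf{R}_{ME}$ be the matrices obtained from $\mathbf{R}$ by, respectively, the ridge regression method and the minimum eigenvalue method with the same target condition number $\kappa_{max}$, and let $\boldsymbol{\Sigma}_{RR}$ and $\boldsymbol{\Sigma}_{ME}$ be their diagonal matrices of standard deviations. Then $$\boldsymbol{\Sigma}_{ME}(i,i)<\boldsymbol{\Sigma}_{RR}(i,i)\quad\text{for all } i\in\{1,\dots,d\}.$$
   Context: Eigenvalues of a symmetric positive semi-definite matrix $\mathbf{S}\in\mathbb{R}^{d\times d}$ are ordered $\lambda_1(\mathbf{S})\ge\dots\ge\lambda_d(\mathbf{S})\ge 0$. The condition number is $\kappa(\mathbf{S})=\lambda_1(\mathbf{S})/\lambda_d(\mathbf{S})$ if $\mathbf{S}$ is positive definite, and $\kappa(\mathbf{S})=\infty$ if $\mathbf{S}$ is singular. The matrix of standard deviations of $\mathbf{S}$ is the diagonal matrix with $(i,i)$ entry $\sqrt{\mathbf{S}(i,i)}$. Ridge regression method: $\mathbf{R}_{RR}=\mathbf{R}+\delta\mathbf{I}_d$ with $\delta=\dfrac{\lambda_1(\mathbf{R})-\lambda_d(\mathbf{R})\kappa_{max}}{\kappa_{max}-1}$. Minimum eigenvalue method: write $\mathbf{R}=\mathbf{V}_{\mathbf{R}}\boldsymbol{\Lambda}\mathbf{V}_{\mathbf{R}}^T$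 with $\boldsymbol{\Lambda}$ diagonal, $\boldsymbol{\Lambda}(k,k)=\lambda_k(\mathbf{R})$, and $\mathbf{V}_{\mathbf{R}}$ a matrix of orthonormal eigenvectors; set $T=\lambda_1(\mathbf{R})/\kappa_{max}$ and $\mathbf{R}_{ME}=\mathbf{V}_{\mathbf{R}}(\boldsymbol{\Lambda}+\boldsymbol{\Gamma})\mathbf{V}_{\mathbf{R}}^T$, where $\boldsymbol{\Gamma}$ is diagonal with $\boldsymbol{\Gamma}(k,k)=\max\{T-\lambda_k(\mathbf{R}),0\}$. *)

theory Defs
  imports "Jordan_Normal_Form.Char_Poly" "HOL-Library.Extended_Real"
begin

definition symmetric_matrix :: "real mat \<Rightarrow> bool" where
  "symmetric_matrix S \<longleftrightarrow> square_mat S \<and> transpose_mat S = S"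

definition pos_semidef :: "real mat \<Rightarrow> bool" where
  "pos_semidef S \<longleftrightarrow> symmetric_matrix S \<and>
     (\<forall>v \<in> carrier_vec (dim_row S). v \<bullet> (S *\<^sub>v v) \<ge> 0)"

definition pos_def :: "real mat \<Rightarrow> bool" where
  "pos_def S \<longleftrightarrow> symmetric_matrix S \<and>
     (\<forall>v \<in> carrier_vec (dim_row S). v \<noteq> 0\<^sub>v (dim_row S) \<longrightarrow> v \<bullet> (S *\<^sub>v v) > 0)"

text \<open>
  The \<open>k\<close>-th largest eigenvalue, counted with multiplicity, with \<open>k\<close> starting at 1 (matrix
  indices start at 0). For a symmetric \<open>d \<times> d\<close> matrix the characteristic polynomial splits over
  the reals, so the list has length \<open>d\<close> and \<open>eigval S k\<close> is meaningful for \<open>1 \<le> k \<le> d\<close>.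
\<close>
definition eigval :: "real mat \<Rightarrow> nat \<Rightarrow> real" where
  "eigval S k = rev (sorted_list_of_multiset (proots (char_poly S))) ! (k - 1)"

text \<open>
  Intended for positive semi-definite matrices, for which not being positive definite is the same
  as being singular.
\<close>
definition cond_number :: "real mat \<Rightarrow> ereal" where
  "cond_number S =
     (if pos_def S then ereal (eigval S 1 / eigval S (dim_row S)) else \<infinity>)"

definition std_dev_matrix :: "real mat \<Rightarrow> real mat" where
  "std_dev_matrix S = mat_diag (dim_row S) (\<lambda>i. sqrt (S $$ (i, i)))"

definition ridge_delta :: "real mat \<Rightarrow> real \<Rightarrow> real" where
  "ridge_delta R \<kappa>max = (eigval R 1 - eigval R (dim_row R) * \<kappa>max) / (\<kappa>max - 1)"

definition ridge_regression :: "real mat \<Rightarrow> real \<Rightarrow> real mat" where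
  "ridge_regression R \<kappa>max = R + ridge_delta R \<kappa>max \<cdot>\<^sub>m 1\<^sub>m (dim_row R)"

definition eigval_matrix :: "real mat \<Rightarrow> real mat" where
  "eigval_matrix R = mat_diag (dim_row R) (\<lambda>k. eigval R (k + 1))"

text \<open>
  The columns of \<open>V\<close> are orthonormal; by the factorisation the column with index \<open>k\<close> is then an
  eigenvector for \<open>eigval R (k + 1)\<close>.
\<close>
definition eigendecomposition :: "real mat \<Rightarrow> real mat \<Rightarrow> bool" where
  "eigendecomposition R V \<longleftrightarrow>
     V \<in> carrier_mat (dim_row R) (dim_row R) \<and>
     transpose_mat V * V = 1\<^sub>m (dim_row R) \<and>
     R = V * eigval_matrix R * transpose_mat V"

definition min_eigval_threshold :: "real mat \<Rightarrow> real \<Rightarrow> real" where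
  "min_eigval_threshold R \<kappa>max = eigval R 1 / \<kappa>max"

definition min_eigval_shift :: "real mat \<Rightarrow> real \<Rightarrow> real mat" where
  "min_eigval_shift R \<kappa>max =
     mat_diag (dim_row R) (\<lambda>k. max (min_eigval_threshold R \<kappa>max - eigval R (k + 1)) 0)"

text \<open>
  A relation between \<open>R\<close> and the result \<open>M\<close>, because the method leaves the choice of the
  orthonormal eigenvectors open.
\<close>
definition min_eigval_method :: "real mat \<Rightarrow> real \<Rightarrow> real mat \<Rightarrow> bool" where
  "min_eigval_method R \<kappa>max M \<longleftrightarrow>
     (\<exists>V. eigendecomposition R V \<and>
          M = V * (eigval_matrix R + min_eigval_shift R \<kappa>max) * transpose_mat V)"

end

theory Submission
  imports Defs
begin

text \<open>
  Each method adds a nonnegative amount to every diagonal entry of \<open>R\<close>, and these increments can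
  be compared entry by entry. Ridge regression adds the same constant \<open>\<delta>\<close> to every diagonal entry. The minimum
  eigenvalue method adds \<open>\<Sum>k. \<Gamma>(k,k) * V(i,k)\<^sup>2\<close> to the entry \<open>(i,i)\<close>, and since the rows of the
  orthogonal matrix \<open>V\<close> are unit vectors, this is a weighted average of the eigenvalue shifts
  \<open>\<Gamma>(k,k)\<close> (\<open>orthogonal_rows_unit\<close>, \<open>diag_entry_conj_mat_diag\<close>). The largest shift is the one of
  the smallest eigenvalue, \<open>max (T - \<lambda>\<^sub>d) 0\<close>, so the average is at most this number.

  With \<open>c = \<lambda>\<^sub>1 - \<lambda>\<^sub>d \<kappa>max\<close>, the largest shift is \<open>max (c / \<kappa>max) 0\<close> while \<open>\<delta> = c / (\<kappa>max - 1)\<close>;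
  so the strict inequality holds as soon as \<open>c > 0\<close> (\<open>largest_shift_less_ridge_delta\<close>). That is
  what \<open>\<kappa>max < \<kappa>(R)\<close> says: if \<open>R\<close> is positive definite then \<open>\<lambda>\<^sub>d > 0\<close> and one can multiply out;
  if \<open>R\<close> is singular then \<open>\<lambda>\<^sub>d = 0\<close> and \<open>c = \<lambda>\<^sub>1 > \<lambda>\<^sub>d = 0\<close>
  (\<open>eigval_ratio_exceeds_target\<close>).
\<close>

section \<open>Conjugation of a diagonal matrix by an orthogonal matrix\<close>

lemma orthogonal_rows_unit:
  fixes V :: "real mat"
  assumes V: "V \<in> carrier_mat n n" and orth: "transpose_mat V * V = 1\<^sub>m n" and i: "i < n"
  shows "(\<Sum>k<n. (V $$ (i, k))\<^sup>2) = 1"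
proof -
  have "V * transpose_mat V = 1\<^sub>m n"
    by (rule mat_mult_left_right_inverse[OF _ V orth]) (use V in auto)
  then have "(V * transpose_mat V) $$ (i, i) = 1" using i by simp
  then show ?thesis
    using V i by (simp add: scalar_prod_def power2_eq_square atLeast0LessThan)
qed

lemma diag_entry_conj_mat_diag:
  fixes V :: "real mat"
  assumes V: "V \<in> carrier_mat n n" and i: "i < n"
  shows "(V * mat_diag n f * transpose_mat V) $$ (i, i) = (\<Sum>k<n. f k * (V $$ (i, k))\<^sup>2)"
  using V i unfolding mat_diag_mult_right[OF V]
  by (auto simp: scalar_prod_def power2_eq_square atLeast0LessThan ac_simps intro!: sum.cong)

lemma quadratic_form_conj_mat_diag:
  fixes V :: "real mat"
  assumes V: "V \<in> carrier_mat n n" and v: "v \<in> carrier_vec n"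
  shows "v \<bullet> ((V * mat_diag n f * transpose_mat V) *\<^sub>v v)
    = (\<Sum>k<n. f k * ((transpose_mat V *\<^sub>v v) $ k)\<^sup>2)"
proof -
  define w where "w = transpose_mat V *\<^sub>v v"
  have w: "w \<in> carrier_vec n" using V v by (simp add: w_def)
  have "(V * mat_diag n f * transpose_mat V) *\<^sub>v v = V *\<^sub>v (mat_diag n f *\<^sub>v w)"
    using V v unfolding w_def
    by (simp add: assoc_mult_mat_vec[of _ n n _ n])
  then have "v \<bullet> ((V * mat_diag n f * transpose_mat V) *\<^sub>v v) = w \<bullet> (mat_diag n f *\<^sub>v w)"
    using transpose_vec_mult_scalar[OF V _ v, of "mat_diag n f *\<^sub>v w"] w
    by (simp add: w_def mult_mat_vec_carrier[of _ n n])
  also have "\<dots> = (\<Sum>k<n. f k * (w $ k)\<^sup>2)"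
  proof -
    have "(mat_diag n f *\<^sub>v w) $ k = f k * w $ k" if "k < n" for k
      using w that
      by (simp add: mat_diag_def scalar_prod_def atLeast0LessThan if_distrib[of "\<lambda>x. x * _"]
          cong: if_cong)
    then show ?thesis
      using w by (auto simp: scalar_prod_def power2_eq_square atLeast0LessThan mat_diag_def ac_simps
          intro!: sum.cong)
  qed
  finally show ?thesis by (simp add: w_def)
qed

section \<open>Order and sign of the eigenvalues\<close>

lemma size_proots_linear_factors:
  "size (proots (\<Prod>a\<leftarrow>as. [:- a, 1:])) = length (as :: 'a :: idom list)"
proof (induction as)
  case (Cons a as)
  have "(\<Prod>a\<leftarrow>as. [:- a, 1:]) \<noteq> 0" by (auto simp: prod_list_zero_iff)
  with Cons show ?case by (simp add: proots_mult del: mult_pCons_left)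
qed simp

text \<open>
  The eigenvalues are read off a list sorted in decreasing order, but the list is long enough
  for all indices up to \<open>n\<close> only because the characteristic polynomial splits; a diagonalisation
  exhibits the splitting.
\<close>
lemma eigval_antimono:
  assumes R: "R \<in> carrier_mat n n" and dec: "eigendecomposition R V"
    and jk: "1 \<le> j" "j \<le> k" "k \<le> n"
  shows "eigval R k \<le> eigval R j"
proof -
  let ?L = "eigval_matrix R"
  have L: "?L \<in> carrier_mat n n" using R by (simp add: eigval_matrix_def)
  have V: "V \<in> carrier_mat n n" and orth: "transpose_mat V * V = 1\<^sub>m n"
    and eq: "R = V * ?L * transpose_mat V"
    using dec R by (auto simp: eigendecomposition_def)
  have "similar_mat_wit R ?L V (transpose_mat V)"
    by (rule similar_mat_witI[OF mat_mult_left_right_inverse[OF _ V orth] orth eq R L V])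
      (use V in auto)
  then have "char_poly R = char_poly ?L"
    by (intro char_poly_similar) (auto simp: similar_mat_def)
  also have "\<dots> = (\<Prod>a\<leftarrow>diag_mat ?L. [:- a, 1:])"
    by (rule char_poly_upper_triangular[OF L]) (auto simp: eigval_matrix_def mat_diag_def)
  finally have "size (proots (char_poly R)) = n"
    using L by (simp add: size_proots_linear_factors diag_mat_def del: map_map)
  then have "length (sorted_list_of_multiset (proots (char_poly R))) = n"
    by (metis mset_sorted_list_of_multiset size_mset)
  then show ?thesis
    unfolding eigval_def using jk by (intro sorted_rev_nth_mono) auto
qed

lemma eigval_quadratic_form:
  assumes R: "R \<in> carrier_mat n n" and dec: "eigendecomposition R V" and v: "v \<in> carrier_vec n"
  shows "v \<bullet> (R *\<^sub>v v) = (\<Sum>k<n. eigval R (k + 1) * ((transpose_mat V *\<^sub>v v) $ k)\<^sup>2)"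
proof -
  have V: "V \<in> carrier_mat n n"
    and eq: "R = V * mat_diag n (\<lambda>k. eigval R (k + 1)) * transpose_mat V"
    using dec R by (auto simp: eigendecomposition_def eigval_matrix_def)
  show ?thesis
    by (subst eq) (rule quadratic_form_conj_mat_diag[OF V v])
qed

text \<open>
  The witness is an eigenvector; this turns the definiteness conditions on \<open>R\<close>, which speak of all
  vectors, into sign conditions on the single eigenvalues.
\<close>
lemma eigval_attained:
  assumes R: "R \<in> carrier_mat n n" and dec: "eigendecomposition R V" and k: "1 \<le> k" "k \<le> n"
  obtains v where "v \<in> carrier_vec n" "v \<noteq> 0\<^sub>v n" "v \<bullet> (R *\<^sub>v v) = eigval R k"
proof
  \<comment> \<open>The index shift: columns are counted from 0, eigenvalues from 1.\<close>
  let ?v = "V *\<^sub>v unit_vec n (k - 1)"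
  have V: "V \<in> carrier_mat n n" and orth: "transpose_mat V * V = 1\<^sub>m n"
    using dec R by (auto simp: eigendecomposition_def)
  show v: "?v \<in> carrier_vec n" using V by auto
  have w: "transpose_mat V *\<^sub>v ?v = unit_vec n (k - 1)"
    using V orth by (simp add: assoc_mult_mat_vec[of _ n n _ n, symmetric])
  show "?v \<noteq> 0\<^sub>v n"
  proof
    assume "?v = 0\<^sub>v n"
    moreover have "transpose_mat V *\<^sub>v 0\<^sub>v n = 0\<^sub>v n" using V by (intro eq_vecI) auto
    ultimately have "unit_vec n (k - 1) = (0\<^sub>v n :: real vec)" using w by simp
    then have "unit_vec n (k - 1) $ (k - 1) = (0\<^sub>v n :: real vec) $ (k - 1)" by simp
    then show False using k by simp
  qed
  have "?v \<bullet> (R *\<^sub>v ?v)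
      = (\<Sum>j<n. if j = k - 1 then eigval R k else 0)"
    unfolding eigval_quadratic_form[OF R dec v] w
    using k by (intro sum.cong) auto
  then show "?v \<bullet> (R *\<^sub>v ?v) = eigval R k" using k by simp
qed

lemma pos_def_if_smallest_eigval_pos:
  assumes R: "R \<in> carrier_mat n n" and sym: "symmetric_matrix R"
    and dec: "eigendecomposition R V" and pos: "eigval R n > 0"
  shows "pos_def R"
  unfolding pos_def_def
proof (intro conjI ballI impI)
  fix v :: "real vec" assume "v \<in> carrier_vec (dim_row R)" and "v \<noteq> 0\<^sub>v (dim_row R)"
  then have v: "v \<in> carrier_vec n" and v0: "v \<noteq> 0\<^sub>v n" using R by auto
  let ?w = "transpose_mat V *\<^sub>v v"
  have V: "V \<in> carrier_mat n n" and orth: "transpose_mat V * V = 1\<^sub>m n"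
    using dec R by (auto simp: eigendecomposition_def)
  have "V * transpose_mat V = 1\<^sub>m n"
    by (rule mat_mult_left_right_inverse[OF _ V orth]) (use V in auto)
  then have Vw: "V *\<^sub>v ?w = v"
    using V v by (simp add: assoc_mult_mat_vec[of _ n n _ n, symmetric])
  have "\<exists>k<n. ?w $ k \<noteq> 0"
  proof (rule ccontr)
    assume "\<not> ?thesis"
    then have "?w = 0\<^sub>v n" using V by (intro eq_vecI) auto
    with Vw V v0 show False by auto
  qed
  then obtain k where k: "k < n" "?w $ k \<noteq> 0" by blast
  have ev: "eigval R (j + 1) > 0" if "j < n" for j
    using eigval_antimono[OF R dec, of "j + 1" n] pos that by simp
  have "0 < (\<Sum>k<n. eigval R (k + 1) * (?w $ k)\<^sup>2)"
    by (rule sum_pos2[of _ k]) (use k ev in \<open>auto simp: less_imp_le\<close>)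
  then show "v \<bullet> (R *\<^sub>v v) > 0"
    by (simp add: eigval_quadratic_form[OF R dec v])
qed (use sym in simp)

section \<open>Comparison of the two increments\<close>

text \<open>
  In multiplied-out form, the hypothesis on the condition number also makes sense when the smallest
  eigenvalue vanishes; it is then the assumption that \<open>R\<close> has two distinct eigenvalues.
\<close>
lemma eigval_ratio_exceeds_target:
  assumes R: "R \<in> carrier_mat n n" and n: "0 < n" and psd: "pos_semidef R"
    and dec: "eigendecomposition R V"
    and gap: "eigval R 1 > eigval R n" and cond: "ereal \<kappa> < cond_number R"
  shows "eigval R n * \<kappa> < eigval R 1"
proof -
  obtain v where v: "v \<in> carrier_vec n" "v \<noteq> 0\<^sub>v n" and ev: "v \<bullet> (R *\<^sub>v v) = eigval R n"
    using eigval_attained[OF R dec, of n] n by auto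
  show ?thesis
  proof (cases "pos_def R")
    case True
    then have "eigval R n > 0" using v ev R by (auto simp: pos_def_def)
    moreover have "\<kappa> < eigval R 1 / eigval R n"
      using cond True R by (simp add: cond_number_def)
    ultimately show ?thesis by (simp add: field_simps)
  next
    case False
    have "eigval R n \<ge> 0" using psd v ev R by (auto simp: pos_semidef_def)
    moreover have "\<not> eigval R n > 0"
      using False pos_def_if_smallest_eigval_pos[OF R _ dec] psd by (auto simp: pos_semidef_def)
    ultimately have "eigval R n = 0" by simp
    with gap show ?thesis by simp
  qed
qed

lemma largest_shift_less_ridge_delta:
  assumes "R \<in> carrier_mat n n" and "1 < \<kappa>" and "eigval R n * \<kappa> < eigval R 1"
  shows "max (min_eigval_threshold R \<kappa> - eigval R n) 0 < ridge_delta R \<kappa>"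
proof -
  let ?c = "eigval R 1 - eigval R n * \<kappa>"
  have "min_eigval_threshold R \<kappa> - eigval R n = ?c / \<kappa>"
    using assms(2) by (simp add: min_eigval_threshold_def field_simps)
  moreover have "?c / \<kappa> < ?c / (\<kappa> - 1)"
    using assms(2,3) by (intro divide_strict_left_mono) auto
  moreover have "0 < ?c / (\<kappa> - 1)" using assms(2,3) by simp
  ultimately show ?thesis using assms(1) by (simp add: ridge_delta_def)
qed

theorem corollary2:
  fixes R R_RR R_ME :: "real mat" and d :: nat and \<kappa>max :: real
  assumes "R \<in> carrier_mat d d"
    and "pos_semidef R"
    and "eigval R 1 > eigval R d"
    and "1 < \<kappa>max"
    and "ereal \<kappa>max < cond_number R"
    and "R_RR = ridge_regression R \<kappa>max"
    and "min_eigval_method R \<kappa>max R_ME"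
  shows "\<forall>i<d. std_dev_matrix R_ME $$ (i, i) < std_dev_matrix R_RR $$ (i, i)"
proof (intro allI impI)
  fix i assume i: "i < d"
  note R = assms(1)
  define \<gamma> where "\<gamma> k = max (min_eigval_threshold R \<kappa>max - eigval R (k + 1)) 0" for k
  define m where "m = max (min_eigval_threshold R \<kappa>max - eigval R d) 0"
  obtain V where dec: "eigendecomposition R V"
    and ME: "R_ME = V * (eigval_matrix R + min_eigval_shift R \<kappa>max) * transpose_mat V"
    using assms(7) by (auto simp: min_eigval_method_def)
  have V: "V \<in> carrier_mat d d" and orth: "transpose_mat V * V = 1\<^sub>m d"
    and R_eq: "R = V * mat_diag d (\<lambda>k. eigval R (k + 1)) * transpose_mat V"
    using dec R by (auto simp: eigendecomposition_def eigval_matrix_def)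
  have "eigval_matrix R + min_eigval_shift R \<kappa>max = mat_diag d (\<lambda>k. eigval R (k + 1) + \<gamma> k)"
    using R by (intro eq_matI)
      (auto simp: eigval_matrix_def min_eigval_shift_def mat_diag_def \<gamma>_def)
  then have ME_eq: "R_ME = V * mat_diag d (\<lambda>k. eigval R (k + 1) + \<gamma> k) * transpose_mat V"
    using ME by simp
  have R_ii: "R $$ (i, i) = (\<Sum>k<d. eigval R (k + 1) * (V $$ (i, k))\<^sup>2)"
    by (subst R_eq) (rule diag_entry_conj_mat_diag[OF V i])
  have "R_ME $$ (i, i) = R $$ (i, i) + (\<Sum>k<d. \<gamma> k * (V $$ (i, k))\<^sup>2)"
    unfolding ME_eq diag_entry_conj_mat_diag[OF V i] R_ii
    by (simp add: distrib_right sum.distrib)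
  also have "(\<Sum>k<d. \<gamma> k * (V $$ (i, k))\<^sup>2) \<le> (\<Sum>k<d. m * (V $$ (i, k))\<^sup>2)"
  proof (intro sum_mono mult_right_mono)
    fix k assume "k \<in> {..<d}"
    then have "eigval R d \<le> eigval R (k + 1)" by (intro eigval_antimono[OF R dec]) auto
    then show "\<gamma> k \<le> m" by (auto simp: \<gamma>_def m_def)
  qed auto
  also have "(\<Sum>k<d. m * (V $$ (i, k))\<^sup>2) = m"
    by (simp add: sum_distrib_left[symmetric] orthogonal_rows_unit[OF V orth i])
  also have "m < ridge_delta R \<kappa>max"
    unfolding m_def using i assms(3)
    by (intro largest_shift_less_ridge_delta[OF R assms(4)]
        eigval_ratio_exceeds_target[OF R _ assms(2) dec _ assms(5)]) auto
  also have "R $$ (i, i) + ridge_delta R \<kappa>max = R_RR $$ (i, i)"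
    using R i by (simp add: assms(6) ridge_regression_def)
  finally have "R_ME $$ (i, i) < R_RR $$ (i, i)" by simp
  moreover have "dim_row R_ME = d" "dim_row R_RR = d"
    using V R by (auto simp: ME_eq assms(6) ridge_regression_def)
  ultimately show "std_dev_matrix R_ME $$ (i, i) < std_dev_matrix R_RR $$ (i, i)"
    using i by (simp add: std_dev_matrix_def mat_diag_def)
qed

end
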